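(* Let $G=\{g_0,\dots,g_{n-1}\}$ be a finite group. If $\nu\in\mathcal{P}(G)$ is an acyclic probability measure and $H$ is the subgroup of $G$ generated by the support of $\nu$, then $$\lim_{m\to\infty}\nu^{m}=\sum_{h\in H}\frac{1}{|H|}\,\delta_h .$$
   Context: For a finite group $G=\{g_0,\dots,g_{n-1}\}$ (written multiplicatively, not assumed abelian, $g_0=e$ the identity), $\mathcal{P}(G)$ denotes the set of probability measures $\sum_{i=0}^{n-1}p_i\delta_{g_i}$ with $p_i\in[0,1]$, $\sum_i p_i=1$; it is identified with the standard simplex $\Delta_n\subset\mathbb{R}^n$ via $\sum_i p_i\delta_{g_i}\leftrightarrow(p_0,\dots,p_{n-1})$, and convergence is convergence of the coefficients (equivalently weak convergence). The convolution is defined by $(\nu*\mu)(f)=\int_G\int_G f(gh)\,d\nu(g)\,d\mu(h)$ for $f:G\to\mathbb{R}$, and $\nu^m=\nu*\cdots*\nu$ ($m$ factors). The support of $\nu$ is $\mathrm{supp}(\nu)=\{g\in G:\nu(g)>0\}$. For $m\ge 1$ put $Z_+(\nu)^m=\{g_{i_1}\cdots g_{i_m}: g_{i_k}\in\mathrm{supp}(\nu)\}$. With $H=\langle\mathrm{supp}(\nu)\rangle$ the subgroup generated by the support, $\nu$ is called acyclic if there exists $N\in\mathbb{N}$, $N\geq 1$, such that $Z_+(\nu)^N=H$. *)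

theory Defs
  imports "HOL-Probability.Probability" "HOL-Algebra.Algebra"
begin

definition prob_measures :: "('a, 'b) monoid_scheme \<Rightarrow> 'a pmf set" where
  "prob_measures G = {\<nu>. set_pmf \<nu> \<subseteq> carrier G}"

definition conv :: "('a, 'b) monoid_scheme \<Rightarrow> 'a pmf \<Rightarrow> 'a pmf \<Rightarrow> 'a pmf" where
  "conv G \<nu> \<mu> = map_pmf (\<lambda>(g, h). g \<otimes>\<^bsub>G\<^esub> h) (pair_pmf \<nu> \<mu>)"

text \<open>The convolution is characterised by its action on functions.\<close>

lemma expectation_conv:
  fixes f :: "'a \<Rightarrow> real"
  assumes "finite (carrier G)" "\<nu> \<in> prob_measures G" "\<mu> \<in> prob_measures G"
  shows "measure_pmf.expectation (conv G \<nu> \<mu>) f =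
    measure_pmf.expectation \<mu> (\<lambda>h. measure_pmf.expectation \<nu> (\<lambda>g. f (g \<otimes>\<^bsub>G\<^esub> h)))"
proof -
  have fin: "finite (set_pmf \<nu>)" "finite (set_pmf \<mu>)"
    using assms by (auto simp: prob_measures_def intro: finite_subset)
  have "measure_pmf.expectation (conv G \<nu> \<mu>) f =
      (\<Sum>(g, h)\<in>set_pmf \<nu> \<times> set_pmf \<mu>. pmf \<nu> g * pmf \<mu> h * f (g \<otimes>\<^bsub>G\<^esub> h))"
    unfolding conv_def integral_map_pmf
    using fin
    by (subst integral_measure_pmf_real[where A = "set_pmf \<nu> \<times> set_pmf \<mu>"])
      (auto simp: pmf_pair intro!: sum.cong)
  also have "\<dots> = (\<Sum>h\<in>set_pmf \<mu>. \<Sum>g\<in>set_pmf \<nu>. pmf \<nu> g * pmf \<mu> h * f (g \<otimes>\<^bsub>G\<^esub> h))"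
    by (subst sum.swap) (simp add: sum.cartesian_product)
  also have "\<dots> = (\<Sum>h\<in>set_pmf \<mu>. (\<Sum>g\<in>set_pmf \<nu>. f (g \<otimes>\<^bsub>G\<^esub> h) * pmf \<nu> g) * pmf \<mu> h)"
    by (simp add: sum_distrib_left sum_distrib_right mult_ac)
  also have "\<dots> = measure_pmf.expectation \<mu>
      (\<lambda>h. measure_pmf.expectation \<nu> (\<lambda>g. f (g \<otimes>\<^bsub>G\<^esub> h)))"
    using fin by (simp add: integral_measure_pmf_real[where A = "set_pmf \<mu>"]
        integral_measure_pmf_real[where A = "set_pmf \<nu>"])
  finally show ?thesis .
qed

text \<open>The exponent \<open>0\<close> is given the value \<open>\<delta>\<^sub>e\<close>, the unit of the convolution, so that
  \<open>conv_power G \<nu> 1 = \<nu>\<close> for \<open>\<nu>\<close> supported in the group.\<close>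

primrec conv_power :: "('a, 'b) monoid_scheme \<Rightarrow> 'a pmf \<Rightarrow> nat \<Rightarrow> 'a pmf" where
  "conv_power G \<nu> 0 = return_pmf \<one>\<^bsub>G\<^esub>"
| "conv_power G \<nu> (Suc m) = conv G (conv_power G \<nu> m) \<nu>"

definition Z_plus :: "('a, 'b) monoid_scheme \<Rightarrow> 'a pmf \<Rightarrow> nat \<Rightarrow> 'a set" where
  "Z_plus G \<nu> m =
    {foldr (\<lambda>g x. g \<otimes>\<^bsub>G\<^esub> x) gs \<one>\<^bsub>G\<^esub> | gs. length gs = m \<and> set gs \<subseteq> set_pmf \<nu>}"

definition acyclic_pmf :: "('a, 'b) monoid_scheme \<Rightarrow> 'a pmf \<Rightarrow> bool" where
  "acyclic_pmf G \<nu> \<longleftrightarrow> (\<exists>N\<ge>1. Z_plus G \<nu> N = generate G (set_pmf \<nu>))"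

end

(* Write U for the uniform measure on H. Acyclicity says that \<nu>^N charges every point of H, so it
   dominates e * card H * U for some e > 0. Since U * p = U for each p supported on H, convolving
   with \<nu>^N contracts the sup distance to U by the factor 1 - e * card H, and
   \<nu>^m is \<nu>^(m mod N) convolved m div N times with \<nu>^N. *)
theory Submission
  imports Defs
begin

context group
begin

text \<open>Conditioning on the right factor first: associativity then reduces to the monad laws
  plus \<open>m_assoc\<close> on the supports, and \<open>pmf_bind\<close> expands a convolution as
  a sum over that factor.\<close>

lemma conv_altdef: "conv G p q = bind_pmf q (\<lambda>h. map_pmf (\<lambda>g. g \<otimes> h) p)"
  unfolding conv_def pair_pmf_def map_pmf_def
  by (subst bind_commute_pmf) (simp add: bind_assoc_pmf bind_return_pmf)

lemma set_pmf_conv: "set_pmf (conv G p q) = (\<lambda>(g, h). g \<otimes> h) ` (set_pmf p \<times> set_pmf q)"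
  by (simp add: conv_def)

lemma conv_one_right:
  assumes "set_pmf p \<subseteq> carrier G"
  shows "conv G p (return_pmf \<one>) = p"
proof -
  have "map_pmf (\<lambda>g. g \<otimes> \<one>) p = map_pmf (\<lambda>g. g) p"
    using assms by (intro map_pmf_cong) auto
  then show ?thesis
    by (simp add: conv_altdef bind_return_pmf)
qed

lemma conv_one_left:
  assumes "set_pmf p \<subseteq> carrier G"
  shows "conv G (return_pmf \<one>) p = p"
proof -
  have "bind_pmf p (\<lambda>h. return_pmf (\<one> \<otimes> h)) = bind_pmf p return_pmf"
    using assms by (intro bind_pmf_cong) auto
  then show ?thesis
    by (simp add: conv_altdef bind_return_pmf')
qed

lemma conv_assoc:
  assumes "set_pmf p \<subseteq> carrier G" "set_pmf q \<subseteq> carrier G" "set_pmf r \<subseteq> carrier G"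
  shows "conv G (conv G p q) r = conv G p (conv G q r)"
proof -
  have "conv G (conv G p q) r =
      bind_pmf r (\<lambda>k. bind_pmf q (\<lambda>h. map_pmf (\<lambda>g. (g \<otimes> h) \<otimes> k) p))"
    by (simp add: conv_altdef map_bind_pmf pmf.map_comp o_def)
  also have "\<dots> = bind_pmf r (\<lambda>k. bind_pmf q (\<lambda>h. map_pmf (\<lambda>g. g \<otimes> (h \<otimes> k)) p))"
    using assms by (intro bind_pmf_cong map_pmf_cong refl m_assoc) auto
  also have "\<dots> = conv G p (conv G q r)"
    by (simp add: conv_altdef bind_assoc_pmf bind_map_pmf)
  finally show ?thesis .
qed

lemma pmf_conv:
  assumes "finite H" "H \<subseteq> carrier G" "set_pmf q \<subseteq> H" "set_pmf p \<subseteq> carrier G" "g \<in> carrier G"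
  shows "pmf (conv G p q) g = (\<Sum>h\<in>H. pmf q h * pmf p (g \<otimes> inv h))"
proof -
  have translate: "pmf (map_pmf (\<lambda>x. x \<otimes> h) p) g = pmf p (g \<otimes> inv h)" if "h \<in> H" for h
  proof -
    have h: "h \<in> carrier G"
      using assms that by auto
    \<comment> \<open>The preimage is taken in the whole type, where the group laws may fail;
      intersecting with the support of \<open>p\<close> keeps \<open>x\<close> in the carrier, so
      that cancelling \<open>h\<close> is legitimate.\<close>
    have "(\<lambda>x. x \<otimes> h) -` {g} \<inter> set_pmf p = {g \<otimes> inv h} \<inter> set_pmf p"
      using assms(4,5) h by (auto simp: m_assoc)
    then have "measure p ((\<lambda>x. x \<otimes> h) -` {g}) = measure p {g \<otimes> inv h}"
      by (metis measure_Int_set_pmf)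
    then show ?thesis
      by (simp add: pmf_map measure_pmf_single)
  qed
  have "pmf (conv G p q) g = (\<Sum>h\<in>H. pmf (map_pmf (\<lambda>x. x \<otimes> h) p) g * pmf q h)"
    unfolding conv_altdef pmf_bind
    using assms by (intro integral_measure_pmf_real) auto
  also have "\<dots> = (\<Sum>h\<in>H. pmf q h * pmf p (g \<otimes> inv h))"
    by (intro sum.cong) (simp_all add: translate)
  finally show ?thesis .
qed

text \<open>An arbitrary subgroup is allowed because two are used: the whole group supplies the side
  conditions of \<open>conv_assoc\<close>, and the generated subgroup confines all powers to
  \<open>H\<close>.\<close>

lemma set_pmf_conv_power:
  assumes "subgroup H G" "set_pmf \<nu> \<subseteq> H"
  shows "set_pmf (conv_power G \<nu> m) \<subseteq> H"
proof (induction m)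
  case 0
  then show ?case
    using assms by (simp add: subgroup.one_closed)
next
  case (Suc m)
  then show ?case
    using assms by (auto simp: set_pmf_conv intro!: subgroup.m_closed)
qed

lemma conv_power_add:
  assumes "set_pmf \<nu> \<subseteq> carrier G"
  shows "conv_power G \<nu> (m + n) = conv G (conv_power G \<nu> m) (conv_power G \<nu> n)"
proof (induction n)
  case 0
  then show ?case
    using set_pmf_conv_power[OF subgroup_self assms] by (simp add: conv_one_right)
next
  case (Suc n)
  then show ?case
    using set_pmf_conv_power[OF subgroup_self assms] assms by (simp add: conv_assoc)
qed

lemma Z_plus_subset_set_pmf:
  assumes "set_pmf \<nu> \<subseteq> carrier G"
  shows "Z_plus G \<nu> m \<subseteq> set_pmf (conv_power G \<nu> m)"
proof -
  have "foldr (\<lambda>g x. g \<otimes> x) gs \<one> \<in> set_pmf (conv_power G \<nu> (length gs))"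
    if "set gs \<subseteq> set_pmf \<nu>" for gs
    using that
  proof (induction gs)
    case Nil
    then show ?case by simp
  next
    case (Cons g gs)
    \<comment> \<open>\<open>conv_power\<close> appends factors on the right, whereas
      \<open>foldr\<close> peels them off on the left; splitting the exponent as 1 + n reconciles
      the two.\<close>
    have "conv_power G \<nu> (length (g # gs)) = conv G \<nu> (conv_power G \<nu> (length gs))"
      using conv_power_add[OF assms, of 1 "length gs"] conv_one_left[OF assms] by simp
    with Cons show ?case
      by (force simp: set_pmf_conv)
  qed
  then show ?thesis
    by (auto simp: Z_plus_def)
qed

text \<open>The deviations of \<open>p\<close> from 1/|H| sum to zero over H, so lowering every
  weight \<open>pmf q h\<close> by \<open>e\<close> does not change their weighted sum. The lowered
  weights are nonnegative with total 1 - e|H|, which is the contraction factor.\<close>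

lemma conv_contracts_to_uniform:
  fixes d e :: real
  assumes H: "subgroup H G" "finite H"
    and q: "set_pmf q \<subseteq> H" "\<And>h. h \<in> H \<Longrightarrow> e \<le> pmf q h"
    and p: "set_pmf p \<subseteq> H"
    and d: "\<And>h. h \<in> H \<Longrightarrow> \<bar>pmf p h - 1 / card H\<bar> \<le> d"
    and g: "g \<in> H"
  shows "\<bar>pmf (conv G p q) g - 1 / card H\<bar> \<le> (1 - e * card H) * d"
proof -
  have sub: "H \<subseteq> carrier G"
    using H(1) by (rule subgroup.subset)
  have sum_q: "(\<Sum>h\<in>H. pmf q h) = 1"
    using q H by (intro sum_pmf_eq_1)
  have sum_p: "(\<Sum>h\<in>H. pmf p (g \<otimes> inv h)) = 1"
  proof -
    have cancel: "g \<otimes> (inv g \<otimes> k) = k" if "k \<in> H" for k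
      using sub g that by (simp add: subset_iff flip: m_assoc)
    \<comment> \<open>The map h -> g h^-1 permutes H, with inverse k -> k^-1 g.\<close>
    have "(\<Sum>h\<in>H. pmf p (g \<otimes> inv h)) = (\<Sum>h\<in>H. pmf p h)"
      by (rule sum.reindex_bij_witness[where i = "\<lambda>k. inv k \<otimes> g" and j = "\<lambda>h. g \<otimes> inv h"])
        (use H sub g in \<open>auto simp: cancel inv_mult_group m_assoc subgroup.m_closed
          subgroup.m_inv_closed subset_iff\<close>)
    also have "\<dots> = 1"
      using p H by (intro sum_pmf_eq_1)
    finally show ?thesis .
  qed
  have "H \<noteq> {}"
    using g by auto
  then have card_H: "real (card H) \<noteq> 0"
    using H by auto
  have "pmf (conv G p q) g = (\<Sum>h\<in>H. pmf q h * pmf p (g \<otimes> inv h))"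
    using H sub q p g by (intro pmf_conv) auto
  \<comment> \<open>On expanding the product, the two terms carrying \<open>e\<close> cancel, since
    \<open>sum_p\<close> equals 1 and 1/|H| summed over H is 1.\<close>
  also have "\<dots> - 1 / card H = (\<Sum>h\<in>H. (pmf q h - e) * (pmf p (g \<otimes> inv h) - 1 / card H))"
    using card_H
    by (simp add: algebra_simps sum.distrib sum_subtractf sum_q sum_p
        flip: sum_distrib_left sum_distrib_right sum_divide_distrib) (simp add: field_simps)
  also have "\<bar>\<dots>\<bar> \<le> (\<Sum>h\<in>H. \<bar>(pmf q h - e) * (pmf p (g \<otimes> inv h) - 1 / card H)\<bar>)"
    by (rule sum_abs)
  also have "\<dots> \<le> (\<Sum>h\<in>H. (pmf q h - e) * d)"
    unfolding abs_mult using H g q(2) d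
    by (intro sum_mono mult_mono) (auto simp: subgroup.m_closed subgroup.m_inv_closed)
  also have "\<dots> = (1 - e * card H) * d"
    by (simp add: sum_subtractf sum_q flip: sum_distrib_right)
  finally show ?thesis .
qed

lemma conv_power_tendsto_uniform:
  assumes H: "subgroup H G" "finite H"
    and \<nu>: "set_pmf \<nu> \<subseteq> H" and N: "N \<ge> 1" "H \<subseteq> set_pmf (conv_power G \<nu> N)"
    and g: "g \<in> H"
  shows "(\<lambda>m. pmf (conv_power G \<nu> m) g) \<longlonglongrightarrow> 1 / card H"
proof -
  define q where "q = conv_power G \<nu> N"
  define e where "e = Min (pmf q ` H)"
  define c where "c = 1 - e * card H"
  have ne: "H \<noteq> {}"
    using g by auto
  have supp: "set_pmf (conv_power G \<nu> m) \<subseteq> H" for m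
    using H(1) \<nu> by (rule set_pmf_conv_power)
  have e_le: "e \<le> pmf q h" if "h \<in> H" for h
    using H that by (simp add: e_def)
  have "e > 0"
    using H ne N by (auto simp: e_def q_def pmf_positive_iff subset_iff)
  then have c_less: "c < 1"
    using H ne by (simp add: c_def card_gt_0_iff)
  \<comment> \<open>|H| copies of the least mass cannot exceed the total mass 1, hence c is
    nonnegative.\<close>
  have "(\<Sum>h\<in>H. e) \<le> (\<Sum>h\<in>H. pmf q h)"
    by (intro sum_mono e_le)
  also have "\<dots> = 1"
    using supp H unfolding q_def by (intro sum_pmf_eq_1)
  finally have c_nonneg: "0 \<le> c"
    by (simp add: c_def mult.commute)
  \<comment> \<open>The bound does not depend on the remainder \<open>r\<close>. For k = 0 it only
    says that two numbers in [0,1] differ by at most 1. The induction hypothesis is needed at all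
    points of H, because one contraction step uses the sup distance.\<close>
  have bound: "\<bar>pmf (conv_power G \<nu> (r + k * N)) h - 1 / card H\<bar> \<le> c ^ k"
    if "h \<in> H" for r k h
    using that
  proof (induction k arbitrary: h)
    case 0
    have "1 \<le> card H"
      using H ne by (simp add: Suc_le_eq card_gt_0_iff)
    then have "1 / real (card H) \<le> 1" "0 \<le> 1 / real (card H)"
      by simp_all
    with pmf_le_1[of "conv_power G \<nu> r" h] pmf_nonneg[of "conv_power G \<nu> r" h]
    have "\<bar>pmf (conv_power G \<nu> r) h - 1 / card H\<bar> \<le> 1"
      by linarith
    then show ?case by simp
  next
    case (Suc k)
    have "conv_power G \<nu> (r + Suc k * N) = conv G (conv_power G \<nu> (r + k * N)) q"
      using conv_power_add[of \<nu> "r + k * N" N] \<nu> subgroup.subset[OF H(1)]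
      by (simp add: q_def add_ac)
    then show ?case
      using conv_contracts_to_uniform[OF H _ e_le supp Suc.IH Suc.prems] supp
      by (simp add: q_def c_def)
  qed
  have "filterlim (\<lambda>m. m div N) at_top sequentially"
    unfolding filterlim_at_top
  proof
    fix k
    have "k \<le> m div N" if "k * N \<le> m" for m
      using that N by (simp add: less_eq_div_iff_mult_less_eq)
    then show "eventually (\<lambda>m. k \<le> m div N) sequentially"
      unfolding eventually_sequentially by blast
  qed
  moreover have "(\<lambda>k. c ^ k) \<longlonglongrightarrow> 0"
    using c_nonneg c_less by (rule LIMSEQ_realpow_zero)
  ultimately have lim: "(\<lambda>m. c ^ (m div N)) \<longlonglongrightarrow> 0"
    by (rule filterlim_compose[rotated])
  \<comment> \<open>Division with remainder: m is m mod N plus (m div N) blocks of length N.\<close>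
  have "\<bar>pmf (conv_power G \<nu> m) g - 1 / card H\<bar> \<le> c ^ (m div N)" for m
    using bound[OF g, of "m mod N" "m div N"] by simp
  then have "(\<lambda>m. pmf (conv_power G \<nu> m) g - 1 / card H) \<longlonglongrightarrow> 0"
    by (intro Lim_null_comparison[OF _ lim]) simp
  then show ?thesis
    by (rule LIM_zero_cancel)
qed

end

theorem theorem1:
  fixes G (structure) and \<nu> :: "'a pmf" and H :: "'a set"
  assumes "group G" and "finite (carrier G)"
    and "\<nu> \<in> prob_measures G" and "acyclic_pmf G \<nu>"
    and "H = generate G (set_pmf \<nu>)"
  shows "\<forall>g\<in>carrier G. (\<lambda>m. pmf (conv_power G \<nu> m) g)
    \<longlonglongrightarrow> (\<Sum>h\<in>H. 1 / real (card H) * pmf (return_pmf h) g)"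
proof
  fix g
  interpret group G by fact
  have \<nu>: "set_pmf \<nu> \<subseteq> carrier G"
    using assms(3) by (simp add: prob_measures_def)
  have H: "subgroup H G"
    unfolding assms(5) using \<nu> by (rule generate_is_subgroup)
  have fin: "finite H"
    using subgroup.subset[OF H] assms(2) by (rule finite_subset)
  have \<nu>H: "set_pmf \<nu> \<subseteq> H"
    unfolding assms(5) by (auto intro: generate.incl)
  obtain N where N: "N \<ge> 1" "Z_plus G \<nu> N = H"
    using assms(4,5) by (auto simp: acyclic_pmf_def)
  \<comment> \<open>The point masses are indicators, so only the summand h = g can survive.\<close>
  have limit: "(\<Sum>h\<in>H. 1 / real (card H) * pmf (return_pmf h) g) =
      (if g \<in> H then 1 / card H else 0)"
    using fin by (simp add: indicator_def of_bool_def if_distrib[of "\<lambda>x. x / _"] cong: if_cong)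
  show "(\<lambda>m. pmf (conv_power G \<nu> m) g)
    \<longlonglongrightarrow> (\<Sum>h\<in>H. 1 / real (card H) * pmf (return_pmf h) g)"
  proof (cases "g \<in> H")
    case True
    then show ?thesis
      using conv_power_tendsto_uniform[OF H fin \<nu>H N(1)] Z_plus_subset_set_pmf[OF \<nu>] N(2)
      unfolding limit by auto
  next
    case False
    \<comment> \<open>Off H the sequence is constantly zero, including m = 0, because the identity
      lies in H.\<close>
    then have "pmf (conv_power G \<nu> m) g = 0" for m
      using set_pmf_conv_power[OF H \<nu>H] by (auto simp: pmf_eq_0_set_pmf)
    with False show ?thesis
      unfolding limit by simp
  qed
qed

end
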